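(* Consider the state-feedback minimax adaptive control problem with data $Q\succ0$, $R\succ 0$, compact $\mathcal M\subset\mathbb R^{n_x\times n_x}\times\mathbb R^{n_x\times n_u}$, $x_0\in\mathbb R^{n_x}$, $\gamma>0$ (see context). For $M=(A,B)\in\mathcal M$ let $$H_M=\begin{bmatrix}Q&0&0\\ 0&R&0\\ 0&0&0\end{bmatrix}-\gamma^2\begin{bmatrix}-A^{\mathsf T}\\ -B^{\mathsf T}\\ I\end{bmatrix}\begin{bmatrix}-A^{\mathsf T}\\ -B^{\mathsf T}\\ I\end{bmatrix}^{\mathsf T},$$ and let $\widehat{\mathcal M}=\{H_M:M\in\mathcal M\}$. Then the value of the state-feedback problem equals the value of the principal problem (see context) with model set $\widehat{\mathcal M}$, $\hat A=0$, $\hat B=0$, $\hat G=I$, under the identification $z_t=x_t$, $d_t=x_{t+1}$ (in particular $z_0=x_0$). Further, given any policy $\hat\mu:(z_0,\dots,z_t,u_0,\dots,u_{t-1},d_0,\dots,d_{t-1})\mapsto u_t$ for the principal problem, the policy $$\mu(x_0,\dots,x_t,u_0,\dots,u_{t-1})=\hat\mu(z_0,\dots,z_t,u_0,\dots,u_{t-1},d_0,\dots,d_{t-1}),\qquad z_s=x_s,\ d_s=x_{s+1},$$ is feasible for the state-feedback problem and $$\sup_{d,\,N,\,H\in\widehat{\mathcal M}}\hat J^N_{\hat\mu}(z_0,H,d)=\sup_{w,\,N,\,M\in\mathcal M}J^N_\mu(x_0,M,w).$$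
   Context: Notation: $\mathbb S^n$ is the space of real symmetric $n\times n$ matrices; $|x|_P^2=x^{\mathsf T}Px$; for a symmetric block matrix $H$, $\sigma_H(x_1,\dots,x_m)=\sum_{i,j}x_i^{\mathsf T}H^{ij}x_j$. For $H$ with blocks indexed by $z,u,d$ and $H^{dd}$ invertible, $H/H^{dd}$ is the Schur complement, with $(a,b)$ block $H^{ab}-H^{ad}(H^{dd})^{-1}H^{db}$, $a,b\in\{z,u\}$. State-feedback problem. $Q\in\mathbb S^{n_x}$, $R\in\mathbb S^{n_u}$ positive definite, $\mathcal M$ compact, $x_0$ and $\gamma>0$ given. For $M=(A,B)\in\mathcal M$, disturbances $w_t\in\mathbb R^{n_x}$ and a policy $\mu$, $x_{t+1}=Ax_t+Bu_t+w_t$, $u_t=\mu_t(x_0,\dots,x_t,u_0,\dots,u_{t-1})$, and $J^N_\mu(x_0,M,w)=\sum_{t=0}^{N-1}(|x_t|_Q^2+|u_t|_R^2-\gamma^2|w_t|^2)$. Its value is $\inf_\mu\sup_{w,N\ge0,M\in\mathcal M}J^N_\mu(x_0,M,w)$. Principal problem. Data: $\hat A\in\mathbb R^{n_z\times n_z}$, $\hat B\in\mathbb R^{n_z\times n_u}$, $\hat G\in\mathbb R^{n_z\times n_d}$, $z_0\in\mathbb R^{n_z}$, and a compact model set $\widehat{\mathcal M}\subset\mathbb S^{n_z+n_u+n_d}$ whose members satisfy $H^{dd}\prec0$, $H/H^{dd}\succeq0$, $[H/H^{dd}]^{uu}\succ0$. Dynamics and policy: $z_{t+1}=\hat Az_t+\hat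 Bu_t+\hat Gd_t$, $u_t=\hat\mu_t(z_0,\dots,z_t,u_0,\dots,u_{t-1},d_0,\dots,d_{t-1})$. Cost: $\hat J^N_{\hat\mu}(z_0,H,d)=\sum_{t=0}^{N-1}\sigma_H(z_t,u_t,d_t)$. Value: $\inf_{\hat\mu}\sup_{H\in\widehat{\mathcal M},d,N\ge0}\hat J^N_{\hat\mu}(z_0,H,d)$. Values are in the extended reals. *)

theory Defs
  imports "HOL-Analysis.Analysis"
begin

definition symmetric_mat :: "real^'n^'n \<Rightarrow> bool" where
  "symmetric_mat P \<longleftrightarrow> transpose P = P"

definition wnorm2 :: "real^'n^'n \<Rightarrow> real^'n \<Rightarrow> real" where
  "wnorm2 P x = x \<bullet> (P *v x)"

definition pos_def :: "real^'n^'n \<Rightarrow> bool" where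
  "pos_def P \<longleftrightarrow> symmetric_mat P \<and> (\<forall>x. x \<noteq> 0 \<longrightarrow> wnorm2 P x > 0)"

definition pos_semidef :: "real^'n^'n \<Rightarrow> bool" where
  "pos_semidef P \<longleftrightarrow> symmetric_mat P \<and> (\<forall>x. wnorm2 P x \<ge> 0)"

definition neg_def :: "real^'n^'n \<Rightarrow> bool" where
  "neg_def P \<longleftrightarrow> symmetric_mat P \<and> (\<forall>x. x \<noteq> 0 \<longrightarrow> wnorm2 P x < 0)"


text \<open>A matrix with row and column blocks z, u, d has index type \<open>'z + 'u + 'd\<close>. A block
  is selected by a pair of index injections.\<close>

definition block :: "('a \<Rightarrow> 'n) \<Rightarrow> ('b \<Rightarrow> 'm) \<Rightarrow> real^'m^'n \<Rightarrow> real^'b^'a" where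
  "block f g H = (\<chi> i j. H $ f i $ g j)"

definition ib_z :: "'z \<Rightarrow> 'z + 'u + 'd" where "ib_z = Inl"
definition ib_u :: "'u \<Rightarrow> 'z + 'u + 'd" where "ib_u = Inr \<circ> Inl"
definition ib_d :: "'d \<Rightarrow> 'z + 'u + 'd" where "ib_d = Inr \<circ> Inr"

definition ib_zu :: "'z + 'u \<Rightarrow> 'z + 'u + 'd" where
  "ib_zu = case_sum ib_z ib_u"

definition sigma_form :: "real^('z + 'u + 'd)^('z + 'u + 'd) \<Rightarrow> real^'z \<Rightarrow> real^'u \<Rightarrow> real^'d \<Rightarrow> real" where
  "sigma_form H z u d =
       z \<bullet> (block ib_z ib_z H *v z) + z \<bullet> (block ib_z ib_u H *v u) + z \<bullet> (block ib_z ib_d H *v d)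
     + u \<bullet> (block ib_u ib_z H *v z) + u \<bullet> (block ib_u ib_u H *v u) + u \<bullet> (block ib_u ib_d H *v d)
     + d \<bullet> (block ib_d ib_z H *v z) + d \<bullet> (block ib_d ib_u H *v u) + d \<bullet> (block ib_d ib_d H *v d)"

text \<open>The Schur complement \<open>H/H\<^sup>d\<^sup>d\<close>. For \<open>a, b \<in> {z, u}\<close> its \<open>(a, b)\<close> block is
  \<open>H\<^sup>a\<^sup>b - H\<^sup>a\<^sup>d (H\<^sup>d\<^sup>d)\<^sup>-\<^sup>1 H\<^sup>d\<^sup>b\<close>.\<close>

definition schur_dd :: "real^('z::finite + 'u::finite + 'd::finite)^('z + 'u + 'd) \<Rightarrow> real^('z + 'u)^('z + 'u)" where
  "schur_dd H = block ib_zu ib_zu H - block ib_zu ib_d H ** matrix_inv (block ib_d ib_d H) ** block ib_d ib_zu H"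


text \<open>
  A policy maps the time \<open>t\<close> and whole signals to an input; causality is a separate predicate.
  In the closed loop \<open>x\<^sub>t\<^sub>+\<^sub>1 = f t x\<^sub>t u\<^sub>t\<close>, \<open>u\<^sub>t = \<mu> t x u\<close>, the signals handed to the
  policy are cut off (padded by 0) after the part already known, so that the recursion is
  well-founded. For causal policies the padding has no effect; see \<open>cl_input_causal\<close> below.
\<close>

function cl_state :: "(nat \<Rightarrow> 'x::zero \<Rightarrow> 'u::zero \<Rightarrow> 'x) \<Rightarrow> (nat \<Rightarrow> (nat \<Rightarrow> 'x) \<Rightarrow> (nat \<Rightarrow> 'u) \<Rightarrow> 'u) \<Rightarrow> 'x
      \<Rightarrow> nat \<Rightarrow> 'x"
  and cl_input :: "(nat \<Rightarrow> 'x::zero \<Rightarrow> 'u::zero \<Rightarrow> 'x) \<Rightarrow> (nat \<Rightarrow> (nat \<Rightarrow> 'x) \<Rightarrow> (nat \<Rightarrow> 'u) \<Rightarrow> 'u) \<Rightarrow> 'x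
      \<Rightarrow> nat \<Rightarrow> 'u"
  where
    "cl_state f \<mu> x0 0 = x0"
  | "cl_state f \<mu> x0 (Suc t) = f t (cl_state f \<mu> x0 t) (cl_input f \<mu> x0 t)"
  | "cl_input f \<mu> x0 t =
       \<mu> t (\<lambda>s. if s \<le> t then cl_state f \<mu> x0 s else 0)
           (\<lambda>s. if s < t then cl_input f \<mu> x0 s else 0)"
  by pat_completeness auto
termination
  by (relation "Wellfounded.measure (case_sum (\<lambda>(_, _, _, t). 2 * t) (\<lambda>(_, _, _, t). 2 * t + 1))") auto

declare cl_input.simps [simp del]


definition sf_policies :: "(nat \<Rightarrow> (nat \<Rightarrow> real^'x) \<Rightarrow> (nat \<Rightarrow> real^'u) \<Rightarrow> real^'u) set" where
  "sf_policies = {\<mu>. \<forall>t x x' u u'.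
      (\<forall>s\<le>t. x s = x' s) \<and> (\<forall>s<t. u s = u' s) \<longrightarrow> \<mu> t x u = \<mu> t x' u'}"

definition sf_dyn :: "(real^'x^'x) \<times> (real^'u^'x) \<Rightarrow> (nat \<Rightarrow> real^'x)
    \<Rightarrow> nat \<Rightarrow> real^'x \<Rightarrow> real^'u \<Rightarrow> real^'x" where
  "sf_dyn M w t x u = fst M *v x + snd M *v u + w t"

definition sf_state where
  "sf_state \<mu> x0 M w = cl_state (sf_dyn M w) \<mu> x0"

definition sf_input where
  "sf_input \<mu> x0 M w = cl_input (sf_dyn M w) \<mu> x0"

definition sf_cost where
  "sf_cost Q R \<gamma> \<mu> N x0 M w =
     (\<Sum>t<N. wnorm2 Q (sf_state \<mu> x0 M w t) + wnorm2 R (sf_input \<mu> x0 M w t) - \<gamma>\<^sup>2 * (norm (w t))\<^sup>2)"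

definition sf_worst :: "real^'x^'x \<Rightarrow> real^'u^'u \<Rightarrow> real \<Rightarrow> ((real^'x^'x) \<times> (real^'u^'x)) set \<Rightarrow> real^'x
    \<Rightarrow> (nat \<Rightarrow> (nat \<Rightarrow> real^'x) \<Rightarrow> (nat \<Rightarrow> real^'u) \<Rightarrow> real^'u) \<Rightarrow> ereal" where
  "sf_worst Q R \<gamma> \<M> x0 \<mu> =
     (SUP (w, N, M) \<in> UNIV \<times> UNIV \<times> \<M>. ereal (sf_cost Q R \<gamma> \<mu> N x0 M w))"

definition sf_value where
  "sf_value Q R \<gamma> \<M> x0 = (INF \<mu> \<in> sf_policies. sf_worst Q R \<gamma> \<M> x0 \<mu>)"


definition pp_policies ::
  "(nat \<Rightarrow> (nat \<Rightarrow> real^'z) \<Rightarrow> (nat \<Rightarrow> real^'u) \<Rightarrow> (nat \<Rightarrow> real^'d) \<Rightarrow> real^'u) set" where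
  "pp_policies = {\<mu>. \<forall>t z z' u u' d d'.
      (\<forall>s\<le>t. z s = z' s) \<and> (\<forall>s<t. u s = u' s) \<and> (\<forall>s<t. d s = d' s) \<longrightarrow> \<mu> t z u d = \<mu> t z' u' d'}"

definition pp_models :: "(real^('z::finite + 'u::finite + 'd::finite)^('z + 'u + 'd)) set \<Rightarrow> bool" where
  "pp_models \<H> \<longleftrightarrow> compact \<H> \<and> (\<forall>H\<in>\<H>. symmetric_mat H \<and> neg_def (block ib_d ib_d H) \<and>
      pos_semidef (schur_dd H) \<and> pos_def (block Inr Inr (schur_dd H)))"

definition pp_dyn :: "real^'z^'z \<Rightarrow> real^'u^'z \<Rightarrow> real^'d^'z \<Rightarrow> (nat \<Rightarrow> real^'d)
    \<Rightarrow> nat \<Rightarrow> real^'z \<Rightarrow> real^'u \<Rightarrow> real^'z" where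
  "pp_dyn A B G d t z u = A *v z + B *v u + G *v d t"

definition pp_state where
  "pp_state A B G \<mu> z0 d = cl_state (pp_dyn A B G d) (\<lambda>t z u. \<mu> t z u d) z0"

definition pp_input where
  "pp_input A B G \<mu> z0 d = cl_input (pp_dyn A B G d) (\<lambda>t z u. \<mu> t z u d) z0"

definition pp_cost where
  "pp_cost A B G \<mu> N z0 H d =
     (\<Sum>t<N. sigma_form H (pp_state A B G \<mu> z0 d t) (pp_input A B G \<mu> z0 d t) (d t))"

definition pp_worst :: "real^'z^'z \<Rightarrow> real^'u^'z \<Rightarrow> real^'d^'z
    \<Rightarrow> (real^('z + 'u + 'd)^('z + 'u + 'd)) set \<Rightarrow> real^'z
    \<Rightarrow> (nat \<Rightarrow> (nat \<Rightarrow> real^'z) \<Rightarrow> (nat \<Rightarrow> real^'u) \<Rightarrow> (nat \<Rightarrow> real^'d) \<Rightarrow> real^'u) \<Rightarrow> ereal" where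
  "pp_worst A B G \<H> z0 \<mu> =
     (SUP (H, d, N) \<in> \<H> \<times> UNIV \<times> UNIV. ereal (pp_cost A B G \<mu> N z0 H d))"

definition pp_value where
  "pp_value A B G \<H> z0 = (INF \<mu> \<in> pp_policies. pp_worst A B G \<H> z0 \<mu>)"


definition block_diag3 :: "real^'z^'z \<Rightarrow> real^'u^'u \<Rightarrow> real^'d^'d
    \<Rightarrow> real^('z + 'u + 'd)^('z + 'u + 'd)" where
  "block_diag3 P1 P2 P3 = (\<chi> i j. case (i, j) of
       (Inl a, Inl b) \<Rightarrow> P1 $ a $ b
     | (Inr (Inl a), Inr (Inl b)) \<Rightarrow> P2 $ a $ b
     | (Inr (Inr a), Inr (Inr b)) \<Rightarrow> P3 $ a $ b
     | _ \<Rightarrow> 0)"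

definition block_col3 :: "real^'n^'z \<Rightarrow> real^'n^'u \<Rightarrow> real^'n^'d \<Rightarrow> real^'n^('z + 'u + 'd)" where
  "block_col3 K1 K2 K3 = (\<chi> i. case i of
       Inl a \<Rightarrow> K1 $ a | Inr (Inl b) \<Rightarrow> K2 $ b | Inr (Inr c) \<Rightarrow> K3 $ c)"

definition H_of :: "real^'x^'x \<Rightarrow> real^'u^'u \<Rightarrow> real \<Rightarrow> (real^'x^'x) \<times> (real^'u^'x)
    \<Rightarrow> real^('x + 'u + 'x)^('x + 'u + 'x)" where
  "H_of Q R \<gamma> M =
     (let K = block_col3 (- transpose (fst M)) (- transpose (snd M)) (mat 1)
      in block_diag3 Q R 0 - \<gamma>\<^sup>2 *\<^sub>R (K ** transpose K))"

definition induced_policy ::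
  "(nat \<Rightarrow> (nat \<Rightarrow> real^'x) \<Rightarrow> (nat \<Rightarrow> real^'u) \<Rightarrow> (nat \<Rightarrow> real^'x) \<Rightarrow> real^'u)
   \<Rightarrow> nat \<Rightarrow> (nat \<Rightarrow> real^'x) \<Rightarrow> (nat \<Rightarrow> real^'u) \<Rightarrow> real^'u" where
  "induced_policy \<mu>h t x u = \<mu>h t x u (\<lambda>s. x (Suc s))"


lemma cl_input_causal:
  assumes "\<And>t x x' u u'. (\<forall>s\<le>t. x s = x' s) \<Longrightarrow> (\<forall>s<t. u s = u' s) \<Longrightarrow> \<mu> t x u = \<mu> t x' u'"
  shows "cl_input f \<mu> x0 t = \<mu> t (cl_state f \<mu> x0) (cl_input f \<mu> x0)"
  by (subst cl_input.simps) (rule assms; simp)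

lemma sf_closed_loop:
  assumes "\<mu> \<in> sf_policies"
  shows "sf_state \<mu> x0 M w 0 = x0"
    and "sf_state \<mu> x0 M w (Suc t) =
           fst M *v sf_state \<mu> x0 M w t + snd M *v sf_input \<mu> x0 M w t + w t"
    and "sf_input \<mu> x0 M w t = \<mu> t (sf_state \<mu> x0 M w) (sf_input \<mu> x0 M w)"
proof -
  show "sf_input \<mu> x0 M w t = \<mu> t (sf_state \<mu> x0 M w) (sf_input \<mu> x0 M w)"
    unfolding sf_input_def sf_state_def
    by (rule cl_input_causal) (use assms in \<open>auto simp: sf_policies_def\<close>)
qed (simp_all add: sf_state_def sf_input_def sf_dyn_def)

lemma pp_closed_loop:
  assumes "\<mu> \<in> pp_policies"
  shows "pp_state A B G \<mu> z0 d 0 = z0"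
    and "pp_state A B G \<mu> z0 d (Suc t) =
           A *v pp_state A B G \<mu> z0 d t + B *v pp_input A B G \<mu> z0 d t + G *v d t"
    and "pp_input A B G \<mu> z0 d t = \<mu> t (pp_state A B G \<mu> z0 d) (pp_input A B G \<mu> z0 d) d"
proof -
  show "pp_input A B G \<mu> z0 d t = \<mu> t (pp_state A B G \<mu> z0 d) (pp_input A B G \<mu> z0 d) d"
    unfolding pp_input_def pp_state_def
    by (rule cl_input_causal) (use assms in \<open>auto simp: pp_policies_def\<close>)
qed (simp_all add: pp_state_def pp_input_def pp_dyn_def)

end

theory Submission imports Defs begin

text \<open>
  Given the state and the input, the disturbance \<open>w\<^sub>t\<close> and the successor state
  \<open>x\<^sub>t\<^sub>+\<^sub>1 = A x\<^sub>t + B u\<^sub>t + w\<^sub>t\<close> determine each other, for every model \<open>M = (A, B)\<close>. So the adversary may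
  as well choose the successor state \<open>d\<^sub>t = x\<^sub>t\<^sub>+\<^sub>1\<close>. The dynamics then no longer depend on the model,
  and the model moves into the stage cost, where \<open>w\<^sub>t = d\<^sub>t - A x\<^sub>t - B u\<^sub>t\<close> turns
  \<open>|x|\<^sub>Q\<^sup>2 + |u|\<^sub>R\<^sup>2 - \<gamma>\<^sup>2 |w|\<^sup>2\<close> into the quadratic form of \<open>H\<^sub>M\<close> (\<open>sigma_form_H_of\<close>).

  For a fixed policy of the principal problem this is a correspondence between the trajectories of
  the two closed loops. It is established in both directions by the same argument: a trajectory of
  one loop satisfies the equations of the other one, and these equations have only one solution
  (\<open>closed_loop_unique\<close>). Hence the two worst-case costs are suprema of the same numbers
  (\<open>pp_worst_eq_sf_worst\<close>). The values agree because every state-feedback policy is induced by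
  a policy of the principal problem, namely the one that ignores \<open>d\<close>.

  The model set is admissible because completing the square over \<open>d\<close> removes the whole
  \<open>\<gamma>\<^sup>2\<close>-term: the best \<open>d\<close> is \<open>A z + B u\<close>, so that \<open>H\<^sub>M/H\<^sub>M\<^sup>d\<^sup>d = diag(Q, R)\<close>
  (\<open>schur_dd_H_of\<close>), while \<open>H\<^sub>M\<^sup>d\<^sup>d = -\<gamma>\<^sup>2 I\<close>; compactness follows from the continuity
  of \<open>M \<mapsto> H\<^sub>M\<close>.
\<close>

section \<open>The matrices of the model set\<close>

lemma block_gram:
  fixes K :: "real^'k^'n"
  shows "block f g (K ** transpose K) = block f id K ** transpose (block g id K)"
  by (simp add: block_def matrix_matrix_mult_def transpose_def vec_eq_iff)

text \<open>
  Selecting a block commutes with the Gram product, so every block of \<open>H\<^sub>M\<close> is obtained from row blocks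
  of the column \<open>K = (-A\<^sup>T, -B\<^sup>T, I)\<close>; all later computations with \<open>H\<^sub>M\<close> start from this form.
\<close>

lemma block_H_of:
  "block f g (H_of Q R \<gamma> M) =
     block f g (block_diag3 Q R 0)
     - \<gamma>\<^sup>2 *\<^sub>R (block f id (block_col3 (- transpose (fst M)) (- transpose (snd M)) (mat 1))
         ** transpose (block g id (block_col3 (- transpose (fst M)) (- transpose (snd M)) (mat 1))))"
  unfolding block_gram[symmetric] H_of_def Let_def by (simp add: block_def vec_eq_iff)

lemma block_col3_blocks:
  "block ib_z id (block_col3 K1 K2 K3) = K1"
  "block ib_u id (block_col3 K1 K2 K3) = K2"
  "block ib_d id (block_col3 K1 K2 K3) = K3"
  by (simp_all add: block_def block_col3_def ib_z_def ib_u_def ib_d_def vec_eq_iff)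

lemma block_diag3_blocks:
  "block ib_z ib_z (block_diag3 P1 P2 P3) = P1"
  "block ib_z ib_u (block_diag3 P1 P2 P3) = 0"
  "block ib_z ib_d (block_diag3 P1 P2 P3) = 0"
  "block ib_u ib_z (block_diag3 P1 P2 P3) = 0"
  "block ib_u ib_u (block_diag3 P1 P2 P3) = P2"
  "block ib_u ib_d (block_diag3 P1 P2 P3) = 0"
  "block ib_d ib_z (block_diag3 P1 P2 P3) = 0"
  "block ib_d ib_u (block_diag3 P1 P2 P3) = 0"
  "block ib_d ib_d (block_diag3 P1 P2 P3) = P3"
  "block ib_zu ib_d (block_diag3 P1 P2 P3) = 0"
  "block ib_d ib_zu (block_diag3 P1 P2 P3) = 0"
  by (auto simp: block_def block_diag3_def ib_z_def ib_u_def ib_d_def ib_zu_def vec_eq_iff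
      split: sum.splits)

lemma transpose_uminus: "transpose (- A) = - transpose (A :: real^'n^'m)"
  by (simp add: transpose_def vec_eq_iff)

lemma inner_gram_perturbation:
  fixes P :: "real^'b^'a" and K :: "real^'k^'a" and L :: "real^'k^'b"
  shows "v \<bullet> ((P - c *\<^sub>R (K ** transpose L)) *v y)
       = v \<bullet> (P *v y) - c * ((transpose K *v v) \<bullet> (transpose L *v y))"
  by (simp add: matrix_vector_mult_diff_rdistrib scaleR_matrix_vector_assoc[symmetric]
      matrix_vector_mul_assoc[symmetric] inner_diff_right dot_lmul_matrix)

lemma matrix_vector_mult_uminus: "(- A) *v x = - (A *v (x :: real^'n))"
  by (simp add: matrix_vector_mult_def vec_eq_iff sum_negf)

text \<open>
  Summed over the nine blocks, the Gram terms form the square \<open>|K\<^sup>T (z, u, d)|\<^sup>2\<close> with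
  \<open>K\<^sup>T (z, u, d) = d - A z - B u\<close>, the disturbance that drives \<open>(z, u)\<close> to the successor \<open>d\<close>.
\<close>

lemma sigma_form_H_of:
  "sigma_form (H_of Q R \<gamma> M) z u d =
     wnorm2 Q z + wnorm2 R u - \<gamma>\<^sup>2 * (norm (d - fst M *v z - snd M *v u))\<^sup>2"
  unfolding sigma_form_def block_H_of block_col3_blocks block_diag3_blocks inner_gram_perturbation
    power2_norm_eq_inner wnorm2_def
  by (simp add: transpose_uminus matrix_vector_mult_uminus inner_diff_left inner_diff_right
      inner_commute algebra_simps)

lemma symmetric_mat_nth: "symmetric_mat P \<Longrightarrow> P $ i $ j = P $ j $ i"
  by (auto simp: symmetric_mat_def transpose_def vec_eq_iff)

lemma symmetric_mat_H_of:
  assumes "symmetric_mat Q" "symmetric_mat R"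
  shows "symmetric_mat (H_of Q R \<gamma> M)"
  by (auto simp: symmetric_mat_def H_of_def Let_def vec_eq_iff transpose_def block_diag3_def
      matrix_matrix_mult_def mult.commute symmetric_mat_nth[OF assms(1)] symmetric_mat_nth[OF assms(2)]
      split: sum.splits)

lemma matrix_inv_scaled_identity:
  assumes "c \<noteq> (0::real)"
  shows "matrix_inv (c *\<^sub>R mat 1 :: real^'n^'n) = inverse c *\<^sub>R mat 1"
proof -
  have "\<exists>B. (c *\<^sub>R mat 1 :: real^'n^'n) ** B = mat 1 \<and> B ** (c *\<^sub>R mat 1) = mat 1"
    using assms by (intro exI[of _ "inverse c *\<^sub>R mat 1"])
      (simp add: matrix_scalar_ac flip: scalar_matrix_assoc)
  from someI_ex[OF this] have "(c *\<^sub>R mat 1) ** matrix_inv (c *\<^sub>R mat 1 :: real^'n^'n) = mat 1"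
    by (simp add: matrix_inv_def)
  then have "c *\<^sub>R matrix_inv (c *\<^sub>R mat 1 :: real^'n^'n) = mat 1"
    by (simp flip: scalar_matrix_assoc)
  then have "inverse c *\<^sub>R mat 1 = inverse c *\<^sub>R (c *\<^sub>R matrix_inv (c *\<^sub>R mat 1 :: real^'n^'n))"
    by simp
  then show ?thesis using assms by simp
qed

lemma block_dd_H_of: "block ib_d ib_d (H_of Q R \<gamma> M) = (- \<gamma>\<^sup>2) *\<^sub>R mat 1"
  by (simp add: block_H_of block_col3_blocks block_diag3_blocks)

text \<open>
  With \<open>L\<close> the \<open>(z, u)\<close> rows of the column \<open>(-A\<^sup>T, -B\<^sup>T, I)\<close>, the correction term of the Schur complement
  is \<open>(-\<gamma>\<^sup>2 L) (-\<gamma>\<^sup>-\<^sup>2 I) (-\<gamma>\<^sup>2 L\<^sup>T) = -\<gamma>\<^sup>2 L L\<^sup>T\<close>, exactly the \<open>\<gamma>\<^sup>2\<close>-part of the \<open>(z, u)\<close> block.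
\<close>

lemma schur_dd_H_of:
  fixes Q :: "real^'x^'x"
  assumes "\<gamma> \<noteq> 0"
  shows "schur_dd (H_of Q R \<gamma> M) = block ib_zu ib_zu (block_diag3 Q R (0 :: real^'x^'x))"
proof -
  have inv: "matrix_inv ((- \<gamma>\<^sup>2) *\<^sub>R mat 1 :: real^'x^'x) = (- inverse (\<gamma>\<^sup>2)) *\<^sub>R mat 1"
    using matrix_inv_scaled_identity[of "- \<gamma>\<^sup>2"] assms by simp
  have neg: "A ** (- B) = - (A ** B)" "(- A) ** B = - (A ** B)"
    for A :: "real^'k^'m" and B :: "real^'n^'k"
    by (simp_all add: matrix_matrix_mult_def vec_eq_iff sum_negf)
  show ?thesis
    unfolding schur_dd_def block_dd_H_of inv
    unfolding block_H_of block_col3_blocks block_diag3_blocks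
    using assms by (simp add: neg matrix_scalar_ac flip: scalar_matrix_assoc)
qed

lemma block_zu_block_diag3:
  "block ib_zu ib_zu (block_diag3 P1 P2 P3) $ i $ j =
     (case (i, j) of (Inl a, Inl b) \<Rightarrow> P1 $ a $ b | (Inr a, Inr b) \<Rightarrow> P2 $ a $ b | _ \<Rightarrow> 0)"
  by (simp add: block_def block_diag3_def ib_zu_def ib_z_def ib_u_def split: sum.splits)

lemma wnorm2_block_diag:
  "wnorm2 (block ib_zu ib_zu (block_diag3 P1 P2 P3)) v =
     wnorm2 P1 (\<chi> i. v $ Inl i) + wnorm2 P2 (\<chi> i. v $ Inr i)"
  by (simp add: wnorm2_def inner_vec_def matrix_vector_mult_def block_zu_block_diag3
      sum.Plus flip: UNIV_Plus_UNIV)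

lemma continuous_on_H_of: "continuous_on S (H_of Q R \<gamma>)"
proof -
  have "continuous_on S (\<lambda>M. case i of Inl a \<Rightarrow> (- transpose (fst M)) $ a
      | Inr (Inl b) \<Rightarrow> (- transpose (snd M)) $ b | Inr (Inr c) \<Rightarrow> mat 1 $ c)" for i
    by (cases i rule: obj_sumE; (cases "projr i" rule: obj_sumE)?)
      (auto simp: transpose_def intro!: continuous_intros)
  then have "continuous_on S (\<lambda>M. block_col3 (- transpose (fst M)) (- transpose (snd M)) (mat 1))"
    unfolding block_col3_def by (rule continuous_on_vec_lambda)
  then show ?thesis
    unfolding H_of_def Let_def matrix_matrix_mult_def transpose_def[of "block_col3 _ _ _"]
    by (intro continuous_intros) simp_all
qed

text \<open>
  The sign conditions hold for each single model, because \<open>H\<^sub>M\<^sup>d\<^sup>d = -\<gamma>\<^sup>2 I\<close> and the Schur complement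
  \<open>diag(Q, R)\<close> do not depend on \<open>M\<close>.
\<close>

lemma pp_models_H_of:
  fixes Q :: "real^'x^'x"
  assumes "pos_def Q" "pos_def R" "compact \<M>" "\<gamma> \<noteq> 0"
  shows "pp_models (H_of Q R \<gamma> ` \<M>)"
proof -
  have sym: "symmetric_mat Q" "symmetric_mat R"
    using assms by (simp_all add: pos_def_def)
  have nonneg: "wnorm2 Q x \<ge> 0" "wnorm2 R y \<ge> 0" for x y
    using assms(1,2) by (cases "x = 0"; cases "y = 0"; force simp: pos_def_def wnorm2_def)+
  have "neg_def (block ib_d ib_d (H_of Q R \<gamma> M))" for M
    using assms(4) by (simp add: block_dd_H_of neg_def_def symmetric_mat_def wnorm2_def
        transpose_scalar transpose_uminus matrix_vector_mult_uminus
        flip: scaleR_matrix_vector_assoc)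
  moreover have "pos_semidef (schur_dd (H_of Q R \<gamma> M))" for M
  proof -
    have "symmetric_mat (block ib_zu ib_zu (block_diag3 Q R (0 :: real^'x^'x)))"
      by (auto simp: symmetric_mat_def transpose_def vec_eq_iff block_zu_block_diag3
          symmetric_mat_nth[OF sym(1)] symmetric_mat_nth[OF sym(2)] split: sum.splits)
    then show ?thesis
      using nonneg by (simp add: schur_dd_H_of[OF assms(4)] pos_semidef_def wnorm2_block_diag)
  qed
  moreover have "pos_def (block Inr Inr (schur_dd (H_of Q R \<gamma> M)))" for M
  proof -
    have "block Inr Inr (schur_dd (H_of Q R \<gamma> M)) = R"
      unfolding schur_dd_H_of[OF assms(4)]
      by (simp add: block_def[of Inr Inr] block_zu_block_diag3 vec_eq_iff)
    then show ?thesis using assms(2) by simp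
  qed
  moreover have "compact (H_of Q R \<gamma> ` \<M>)"
    using compact_continuous_image[OF continuous_on_H_of assms(3)] .
  ultimately show ?thesis
    using symmetric_mat_H_of[OF sym] by (auto simp: pp_models_def)
qed

section \<open>The correspondence of trajectories\<close>

text \<open>
  The closed loop hands signals to the policy that are cut off after the known part. By causality
  the policy cannot tell them from the uncut trajectory, so a trajectory that satisfies the loop
  equations with uncut signals agrees with the closed loop, by induction on time.
\<close>

lemma closed_loop_unique:
  assumes causal: "\<And>t x x' u u'. (\<forall>s\<le>t. x s = x' s) \<Longrightarrow> (\<forall>s<t. u s = u' s) \<Longrightarrow> \<mu> t x u = \<mu> t x' u'"
    and "x 0 = x0" "\<And>t. x (Suc t) = f t (x t) (u t)" "\<And>t. u t = \<mu> t x u"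
  shows "x = cl_state f \<mu> x0" "u = cl_input f \<mu> x0"
proof -
  have "\<forall>s\<le>t. x s = cl_state f \<mu> x0 s \<and> u s = cl_input f \<mu> x0 s" for t
  proof (induction t)
    case 0
    have "u 0 = cl_input f \<mu> x0 0"
      unfolding assms(4)[of 0] cl_input.simps[of f \<mu> x0 0] by (rule causal) (simp_all add: assms(2))
    then show ?case by (simp add: assms(2))
  next
    case (Suc t)
    have x: "x (Suc t) = cl_state f \<mu> x0 (Suc t)"
      using Suc by (simp add: assms(3))
    have "u (Suc t) = cl_input f \<mu> x0 (Suc t)"
      unfolding assms(4)[of "Suc t"] cl_input.simps[of f \<mu> x0 "Suc t"]
      by (rule causal) (use Suc x in \<open>auto simp: le_Suc_eq less_Suc_eq_le\<close>)
    with x Suc show ?case by (auto simp: le_Suc_eq)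
  qed
  then show "x = cl_state f \<mu> x0" "u = cl_input f \<mu> x0" by auto
qed

lemma sf_closed_loop_unique:
  assumes "\<mu> \<in> sf_policies"
    and "x 0 = x0" "\<And>t. x (Suc t) = fst M *v x t + snd M *v u t + w t" "\<And>t. u t = \<mu> t x u"
  shows "x = sf_state \<mu> x0 M w" "u = sf_input \<mu> x0 M w"
proof -
  have causal: "\<mu> t x u = \<mu> t x' u'" if "\<forall>s\<le>t. x s = x' s" "\<forall>s<t. u s = u' s" for t x x' u u'
    using assms(1) that unfolding sf_policies_def by blast
  have dyn: "x (Suc t) = sf_dyn M w t (x t) (u t)" for t
    unfolding sf_dyn_def by (rule assms(3))
  show "x = sf_state \<mu> x0 M w" "u = sf_input \<mu> x0 M w"
    unfolding sf_state_def sf_input_def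
    using closed_loop_unique[of \<mu> x x0 "sf_dyn M w" u, OF causal assms(2) dyn assms(4)] by blast+
qed

lemma pp_closed_loop_unique:
  assumes "\<mu> \<in> pp_policies"
    and "x 0 = z0" "\<And>t. x (Suc t) = A *v x t + B *v u t + G *v d t" "\<And>t. u t = \<mu> t x u d"
  shows "x = pp_state A B G \<mu> z0 d" "u = pp_input A B G \<mu> z0 d"
proof -
  have causal: "\<mu> t x u d = \<mu> t x' u' d" if "\<forall>s\<le>t. x s = x' s" "\<forall>s<t. u s = u' s" for t x x' u u'
    using assms(1) that unfolding pp_policies_def by blast
  have dyn: "x (Suc t) = pp_dyn A B G d t (x t) (u t)" for t
    unfolding pp_dyn_def by (rule assms(3))
  show "x = pp_state A B G \<mu> z0 d" "u = pp_input A B G \<mu> z0 d"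
    unfolding pp_state_def pp_input_def
    using closed_loop_unique[of "\<lambda>t x u. \<mu> t x u d" x z0 "pp_dyn A B G d" u,
        OF causal assms(2) dyn assms(4)] by blast+
qed

text \<open>
  At time \<open>t\<close> the policy reads \<open>d\<^sub>s = x\<^sub>s\<^sub>+\<^sub>1\<close> only for \<open>s < t\<close>, and then \<open>s + 1 \<le> t\<close>.
\<close>

lemma induced_policy_feasible:
  assumes "\<mu>h \<in> pp_policies"
  shows "induced_policy \<mu>h \<in> sf_policies"
  using assms by (simp add: sf_policies_def pp_policies_def induced_policy_def Suc_le_eq)

text \<open>
  Along a state-feedback trajectory, the disturbance \<open>d\<^sub>t = x\<^sub>t\<^sub>+\<^sub>1\<close> makes the shifted states read by the induced
  policy equal to the signal \<open>d\<close> read by \<open>\<mu>h\<close>, so the trajectory solves the equations of the principal problem.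
\<close>

lemma pp_trajectory_of_sf:
  assumes "\<mu>h \<in> pp_policies"
    and d: "\<And>t. d t = sf_state (induced_policy \<mu>h) x0 M w (Suc t)"
  shows "pp_state 0 0 (mat 1) \<mu>h x0 d = sf_state (induced_policy \<mu>h) x0 M w"
    and "pp_input 0 0 (mat 1) \<mu>h x0 d = sf_input (induced_policy \<mu>h) x0 M w"
proof -
  note sf = sf_closed_loop[OF induced_policy_feasible[OF assms(1)], of x0 M w]
  have u: "sf_input (induced_policy \<mu>h) x0 M w t
      = \<mu>h t (sf_state (induced_policy \<mu>h) x0 M w) (sf_input (induced_policy \<mu>h) x0 M w) d" for t
    using sf(3)[of t] unfolding induced_policy_def[of \<mu>h t] d[symmetric] .
  have x: "sf_state (induced_policy \<mu>h) x0 M w (Suc t)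
      = 0 *v sf_state (induced_policy \<mu>h) x0 M w t + 0 *v sf_input (induced_policy \<mu>h) x0 M w t
        + mat 1 *v d t" for t
    by (simp add: d)
  show "pp_state 0 0 (mat 1) \<mu>h x0 d = sf_state (induced_policy \<mu>h) x0 M w"
    by (rule pp_closed_loop_unique(1)[where x = "sf_state (induced_policy \<mu>h) x0 M w"
        and u = "sf_input (induced_policy \<mu>h) x0 M w", OF assms(1) sf(1) x u, symmetric])
  show "pp_input 0 0 (mat 1) \<mu>h x0 d = sf_input (induced_policy \<mu>h) x0 M w"
    by (rule pp_closed_loop_unique(2)[where x = "sf_state (induced_policy \<mu>h) x0 M w"
        and u = "sf_input (induced_policy \<mu>h) x0 M w", OF assms(1) sf(1) x u, symmetric])
qed

text \<open>
  Every \<open>d\<close> is reached, whatever the model: \<open>w\<close> is chosen to cancel the predicted part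
  \<open>A z\<^sub>t + B u\<^sub>t\<close> and put \<open>d\<^sub>t\<close> in its place.
\<close>

lemma sf_trajectory_of_pp:
  assumes "\<mu>h \<in> pp_policies"
    and w: "\<And>t. w t = d t - fst M *v pp_state 0 0 (mat 1) \<mu>h x0 d t
                        - snd M *v pp_input 0 0 (mat 1) \<mu>h x0 d t"
  shows "sf_state (induced_policy \<mu>h) x0 M w = pp_state 0 0 (mat 1) \<mu>h x0 d"
    and "sf_input (induced_policy \<mu>h) x0 M w = pp_input 0 0 (mat 1) \<mu>h x0 d"
proof -
  note feas = induced_policy_feasible[OF assms(1)]
  note pp = pp_closed_loop[OF assms(1), of 0 0 "mat 1" x0 d]
  have d: "d t = pp_state 0 0 (mat 1) \<mu>h x0 d (Suc t)" for t
    by (simp add: pp(2))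
  have x: "pp_state 0 0 (mat 1) \<mu>h x0 d (Suc t)
      = fst M *v pp_state 0 0 (mat 1) \<mu>h x0 d t + snd M *v pp_input 0 0 (mat 1) \<mu>h x0 d t + w t" for t
    by (simp add: w flip: d)
  have u: "pp_input 0 0 (mat 1) \<mu>h x0 d t
      = induced_policy \<mu>h t (pp_state 0 0 (mat 1) \<mu>h x0 d) (pp_input 0 0 (mat 1) \<mu>h x0 d)" for t
    using pp(3)[of t] unfolding induced_policy_def d[symmetric] .
  show "sf_state (induced_policy \<mu>h) x0 M w = pp_state 0 0 (mat 1) \<mu>h x0 d"
    by (rule sf_closed_loop_unique(1)[where x = "pp_state 0 0 (mat 1) \<mu>h x0 d"
        and u = "pp_input 0 0 (mat 1) \<mu>h x0 d", OF feas pp(1) x u, symmetric])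
  show "sf_input (induced_policy \<mu>h) x0 M w = pp_input 0 0 (mat 1) \<mu>h x0 d"
    by (rule sf_closed_loop_unique(2)[where x = "pp_state 0 0 (mat 1) \<mu>h x0 d"
        and u = "pp_input 0 0 (mat 1) \<mu>h x0 d", OF feas pp(1) x u, symmetric])
qed

section \<open>Equality of the worst-case costs and of the values\<close>

lemma pp_cost_eq_sf_cost:
  assumes "pp_state 0 0 (mat 1) \<mu>h x0 d = sf_state \<mu> x0 M w"
    and "pp_input 0 0 (mat 1) \<mu>h x0 d = sf_input \<mu> x0 M w"
    and "\<And>t. d t = sf_state \<mu> x0 M w (Suc t)"
  shows "pp_cost 0 0 (mat 1) \<mu>h N x0 (H_of Q R \<gamma> M) d = sf_cost Q R \<gamma> \<mu> N x0 M w"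
proof -
  have "d t - fst M *v sf_state \<mu> x0 M w t - snd M *v sf_input \<mu> x0 M w t = w t" for t
    by (simp add: assms(3)) (simp add: sf_state_def sf_input_def sf_dyn_def)
  then show ?thesis
    by (simp add: pp_cost_def sf_cost_def sigma_form_H_of assms(1,2))
qed

lemma pp_worst_eq_sf_worst:
  fixes \<M> :: "((real^'x^'x) \<times> (real^'u^'x)) set"
  assumes "\<mu>h \<in> pp_policies"
  shows "pp_worst 0 0 (mat 1) (H_of Q R \<gamma> ` \<M>) x0 \<mu>h = sf_worst Q R \<gamma> \<M> x0 (induced_policy \<mu>h)"
proof (rule antisym)
  show "pp_worst 0 0 (mat 1) (H_of Q R \<gamma> ` \<M>) x0 \<mu>h \<le> sf_worst Q R \<gamma> \<M> x0 (induced_policy \<mu>h)"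
    unfolding pp_worst_def
  proof (rule SUP_least)
    fix p assume "p \<in> (H_of Q R \<gamma> ` \<M>) \<times> (UNIV :: (nat \<Rightarrow> real^'x) set) \<times> (UNIV :: nat set)"
    then obtain M d N where M: "M \<in> \<M>" and p: "p = (H_of Q R \<gamma> M, d, N)"
      by (elim SigmaE imageE) simp
    define w where "w t = d t - fst M *v pp_state 0 0 (mat 1) \<mu>h x0 d t
                              - snd M *v pp_input 0 0 (mat 1) \<mu>h x0 d t" for t
    note traj = sf_trajectory_of_pp[OF assms, of w d M x0, OF w_def]
    have "d t = sf_state (induced_policy \<mu>h) x0 M w (Suc t)" for t
      by (simp add: traj pp_closed_loop(2)[OF assms])
    from pp_cost_eq_sf_cost[OF traj[symmetric] this]
    show "(case p of (H, d, N) \<Rightarrow> ereal (pp_cost 0 0 (mat 1) \<mu>h N x0 H d))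
        \<le> sf_worst Q R \<gamma> \<M> x0 (induced_policy \<mu>h)"
      unfolding sf_worst_def by (intro SUP_upper2[of "(w, N, M)"]) (simp_all add: M p)
  qed
  show "sf_worst Q R \<gamma> \<M> x0 (induced_policy \<mu>h) \<le> pp_worst 0 0 (mat 1) (H_of Q R \<gamma> ` \<M>) x0 \<mu>h"
    unfolding sf_worst_def
  proof (rule SUP_least)
    fix p assume "p \<in> (UNIV :: (nat \<Rightarrow> real^'x) set) \<times> (UNIV :: nat set) \<times> \<M>"
    then obtain w N M where M: "M \<in> \<M>" and p: "p = (w, N, M)"
      by (elim SigmaE) simp
    define d where "d t = sf_state (induced_policy \<mu>h) x0 M w (Suc t)" for t
    from pp_cost_eq_sf_cost[OF pp_trajectory_of_sf[OF assms d_def] d_def]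
    show "(case p of (w, N, M) \<Rightarrow> ereal (sf_cost Q R \<gamma> (induced_policy \<mu>h) N x0 M w))
        \<le> pp_worst 0 0 (mat 1) (H_of Q R \<gamma> ` \<M>) x0 \<mu>h"
      unfolding pp_worst_def by (intro SUP_upper2[of "(H_of Q R \<gamma> M, d, N)"]) (simp_all add: M p)
  qed
qed

lemma sf_policies_eq_induced:
  "(sf_policies :: (nat \<Rightarrow> (nat \<Rightarrow> real^'x) \<Rightarrow> (nat \<Rightarrow> real^'u) \<Rightarrow> real^'u) set)
     = induced_policy ` pp_policies"
  (is "?S = ?I")
proof
  show "?I \<subseteq> ?S"
    by (auto intro: induced_policy_feasible)
  show "?S \<subseteq> ?I"
  proof
    fix \<mu> :: "nat \<Rightarrow> (nat \<Rightarrow> real^'x) \<Rightarrow> (nat \<Rightarrow> real^'u) \<Rightarrow> real^'u"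
    define \<mu>h where "\<mu>h t z u d = \<mu> t z u" for t z u and d :: "nat \<Rightarrow> real^'x"
    assume "\<mu> \<in> sf_policies"
    then have "\<mu>h \<in> pp_policies"
      unfolding \<mu>h_def sf_policies_def pp_policies_def by blast
    moreover have "\<mu> = induced_policy \<mu>h"
      by (simp add: \<mu>h_def induced_policy_def fun_eq_iff)
    ultimately show "\<mu> \<in> ?I" by simp
  qed
qed

lemma sf_value_eq_pp_value:
  "sf_value Q R \<gamma> \<M> x0 = pp_value 0 0 (mat 1) (H_of Q R \<gamma> ` \<M>) x0"
  by (simp add: sf_value_def pp_value_def sf_policies_eq_induced image_image pp_worst_eq_sf_worst)

theorem theorem2:
  fixes Q :: "real^'x^'x" and R :: "real^'u^'u" and \<gamma> :: real
    and \<M> :: "((real^'x^'x) \<times> (real^'u^'x)) set" and x0 :: "real^'x"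
  assumes "pos_def Q" and "pos_def R" and "compact \<M>" and "\<gamma> > 0"
  shows "pp_models (H_of Q R \<gamma> ` \<M>)
    \<and> sf_value Q R \<gamma> \<M> x0 = pp_value 0 0 (mat 1) (H_of Q R \<gamma> ` \<M>) x0
    \<and> (\<forall>\<mu>h \<in> pp_policies.
         induced_policy \<mu>h \<in> sf_policies
       \<and> (\<forall>M\<in>\<M>. \<forall>w d. (\<forall>t. d t = sf_state (induced_policy \<mu>h) x0 M w (Suc t)) \<longrightarrow>
            (\<forall>t. pp_state 0 0 (mat 1) \<mu>h x0 d t = sf_state (induced_policy \<mu>h) x0 M w t
               \<and> pp_input 0 0 (mat 1) \<mu>h x0 d t = sf_input (induced_policy \<mu>h) x0 M w t))
       \<and> pp_worst 0 0 (mat 1) (H_of Q R \<gamma> ` \<M>) x0 \<mu>h = sf_worst Q R \<gamma> \<M> x0 (induced_policy \<mu>h))"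
proof (intro conjI ballI allI impI)
  show "pp_models (H_of Q R \<gamma> ` \<M>)"
    using assms by (intro pp_models_H_of) auto
  show "sf_value Q R \<gamma> \<M> x0 = pp_value 0 0 (mat 1) (H_of Q R \<gamma> ` \<M>) x0"
    by (rule sf_value_eq_pp_value)
  fix \<mu>h :: "nat \<Rightarrow> (nat \<Rightarrow> real^'x) \<Rightarrow> (nat \<Rightarrow> real^'u) \<Rightarrow> (nat \<Rightarrow> real^'x) \<Rightarrow> real^'u"
  assume "\<mu>h \<in> pp_policies"
  note policy = this
  show "induced_policy \<mu>h \<in> sf_policies"
    by (rule induced_policy_feasible[OF policy])
  show "pp_worst 0 0 (mat 1) (H_of Q R \<gamma> ` \<M>) x0 \<mu>h = sf_worst Q R \<gamma> \<M> x0 (induced_policy \<mu>h)"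
    by (rule pp_worst_eq_sf_worst[OF policy])
  fix M w d t
  assume "\<forall>t. d t = sf_state (induced_policy \<mu>h) x0 M w (Suc t)"
  then have d: "d t = sf_state (induced_policy \<mu>h) x0 M w (Suc t)" for t by simp
  show "pp_state 0 0 (mat 1) \<mu>h x0 d t = sf_state (induced_policy \<mu>h) x0 M w t"
    by (simp only: pp_trajectory_of_sf(1)[OF policy d])
  show "pp_input 0 0 (mat 1) \<mu>h x0 d t = sf_input (induced_policy \<mu>h) x0 M w t"
    by (simp only: pp_trajectory_of_sf(2)[OF policy d])
qed

end
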